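(* Let $P$ be the distribution of the binary random vector $X=(X_v)_{v\in V}$ of a discrete determinantal point process on a finite set $V$ with kernel $K$. Then the context-specific independence model $\mathcal{J}_{\cdot\mid X_C=1_C}(P)$ is faithful to the undirected graph $G_u(P)$ if and only if $\mathcal{J}_{\cdot\mid X_C=1_C}(P)$ satisfies upward-stability.
   Context: Let $V$ be a finite set. A (discrete) determinantal point process (DPP) on $V$ with kernel $K$ is a random subset $Y$ of $V$ such that $\mathbb{P}(A\subseteq Y)=\det(K_A)$ for all non-empty $A\subseteq V$, where $K\in\mathbb{R}^{V\times V}$ is a (symmetric) positive definite matrix with all eigenvalues at most $1$, and $K_A$ is the principal submatrix of $K$ with rows and columns indexed by $A$. Equivalently, the DPP is the binary random vector $X=(X_v)_{v\in V}\in\{0,1\}^V$ with $X_v=1$ iff $v\in Y$. For $A\subseteq V$, $X_A=(X_v)_{v\in A}$, and $1_A$ is the all-ones vector indexed by $A$. For pairwise disjoint $A,B,C\subseteq V$, write $A\perp\!\!\!\perp B\mid (C=1_C)$ if $X_A$ and $X_B$ are independent under the conditional distribution $P(\cdot\mid X_C=1_C)$ (under $P$ itself if $C=\varnothing$; trivially true if $A$ or $B$ is empty). The context-specific independence model $\mathcal{J}_{\cdot\mid X_C=1_C}(P)$ is the set of all triples $\langle A,B\mid C\rangle$ (with $C$ ranging over all subsets) such that $A\perp\!\!\!\perp B\mid (C=1_C)$. Upward-stability of $\mathcal{J}_{\cdot\mid X_C=1_C}(P)$: for all distinct $i,j\in V$ and $C\subseteq V\setminus\{i,j\}$, if $i\perp\!\!\!\perp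 j\mid (C=1_C)$ then $i\perp\!\!\!\perp j\mid (C\cup\{k\}=1_{C\cup\{k\}})$ for every $k\in V\setminus\{i,j\}$. $G_u(P)$ is the undirected graph with node set $V$ in which distinct nodes $i$ and $j$ are non-adjacent if and only if $(K^{-1})_{ij}=0$. For pairwise disjoint $A,B,C\subseteq V$ with $A,B$ non-empty, write $A\perp_u B\mid C$ if every path in $G_u(P)$ between a vertex of $A$ and a vertex of $B$ contains a vertex of $C$. The model $\mathcal{J}_{\cdot\mid X_C=1_C}(P)$ is faithful to $G_u(P)$ if for all such $A,B,C$: $A\perp_u B\mid C$ if and only if $A\perp\!\!\!\perp B\mid (C=1_C)$. *)

theory Defs
  imports "HOL-Probability.Probability" "HOL-Combinatorics.Permutations"
begin

text \<open>
  The finite ground set is the type \<open>'v\<close>, and \<open>K\<close> is a matrix indexed by it. A binary random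
  vector takes values in \<open>'v \<Rightarrow> bool\<close>, with \<^const>\<open>True\<close> for 1 and \<^const>\<open>False\<close> for 0; its
  distribution is a \<^type>\<open>pmf\<close> on that type.
\<close>

text \<open>
  Since matrices are indexed by types, the determinant of the principal submatrix on a set \<open>A\<close> of
  indices is given by the Leibniz formula that defines \<^const>\<open>det\<close>, with \<open>A\<close> in place of
  \<^const>\<open>UNIV\<close>.
\<close>

definition principal_minor :: "real^'v^'v \<Rightarrow> 'v::finite set \<Rightarrow> real" where
  "principal_minor K A =
    (\<Sum>p | p permutes A. of_int (sign p) * (\<Prod>i\<in>A. K $ i $ p i))"

lemma principal_minor_UNIV: "principal_minor K UNIV = det K"
  by (simp add: principal_minor_def det_def)

definition positive_definite :: "real^'v^'v::finite \<Rightarrow> bool" where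
  "positive_definite K \<longleftrightarrow> transpose K = K \<and> (\<forall>x. x \<noteq> 0 \<longrightarrow> x \<bullet> (K *v x) > 0)"

definition eigenvalue :: "real^'v^'v::finite \<Rightarrow> real \<Rightarrow> bool" where
  "eigenvalue K l \<longleftrightarrow> (\<exists>x. x \<noteq> 0 \<and> K *v x = l *\<^sub>R x)"

definition dpp :: "('v::finite \<Rightarrow> bool) pmf \<Rightarrow> real^'v^'v \<Rightarrow> bool" where
  "dpp P K \<longleftrightarrow>
    positive_definite K \<and> (\<forall>l. eigenvalue K l \<longrightarrow> l \<le> 1) \<and>
    (\<forall>A. A \<noteq> {} \<longrightarrow> measure_pmf.prob P {x. \<forall>v\<in>A. x v} = principal_minor K A)"

text \<open>
  \<open>X\<^sub>A\<close> is the map \<open>\<lambda>x. restrict x A\<close>. For a determinantal point process the conditioning event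
  has probability \<open>principal_minor K C > 0\<close>, so that \<^const>\<open>cond_pmf\<close> is the conditional
  distribution.
\<close>

definition context_indep ::
  "('v::finite \<Rightarrow> bool) pmf \<Rightarrow> 'v set \<Rightarrow> 'v set \<Rightarrow> 'v set \<Rightarrow> bool" where
  "context_indep P A B C \<longleftrightarrow>
    prob_space.indep_var (measure_pmf (cond_pmf P {x. \<forall>v\<in>C. x v}))
      (count_space UNIV) (\<lambda>x. restrict x A) (count_space UNIV) (\<lambda>x. restrict x B)"

definition pairwise_disjoint :: "'v set \<Rightarrow> 'v set \<Rightarrow> 'v set \<Rightarrow> bool" where
  "pairwise_disjoint A B C \<longleftrightarrow> A \<inter> B = {} \<and> A \<inter> C = {} \<and> B \<inter> C = {}"

definition context_indep_model ::
  "('v::finite \<Rightarrow> bool) pmf \<Rightarrow> ('v set \<times> 'v set \<times> 'v set) set" where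
  "context_indep_model P = {(A, B, C). pairwise_disjoint A B C \<and> context_indep P A B C}"

definition upward_stable :: "('v set \<times> 'v set \<times> 'v set) set \<Rightarrow> bool" where
  "upward_stable J \<longleftrightarrow>
    (\<forall>i j C. i \<noteq> j \<longrightarrow> C \<subseteq> UNIV - {i, j} \<longrightarrow> ({i}, {j}, C) \<in> J \<longrightarrow>
      (\<forall>k \<in> UNIV - {i, j}. ({i}, {j}, C \<union> {k}) \<in> J))"

text \<open>An undirected graph with node set \<open>UNIV :: 'v set\<close> is given by its adjacency relation.\<close>

definition G_u :: "real^'v^'v::finite \<Rightarrow> 'v \<Rightarrow> 'v \<Rightarrow> bool" where
  "G_u K i j \<longleftrightarrow> i \<noteq> j \<and> matrix_inv K $ i $ j \<noteq> 0"

definition is_path :: "('v \<Rightarrow> 'v \<Rightarrow> bool) \<Rightarrow> 'v \<Rightarrow> 'v list \<Rightarrow> 'v \<Rightarrow> bool" where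
  "is_path G a p b \<longleftrightarrow>
    p \<noteq> [] \<and> hd p = a \<and> last p = b \<and> distinct p \<and> successively G p"

definition separated :: "('v \<Rightarrow> 'v \<Rightarrow> bool) \<Rightarrow> 'v set \<Rightarrow> 'v set \<Rightarrow> 'v set \<Rightarrow> bool" where
  "separated G A B C \<longleftrightarrow>
    (\<forall>a\<in>A. \<forall>b\<in>B. \<forall>p. is_path G a p b \<longrightarrow> set p \<inter> C \<noteq> {})"

definition faithful ::
  "('v set \<times> 'v set \<times> 'v set) set \<Rightarrow> ('v \<Rightarrow> 'v \<Rightarrow> bool) \<Rightarrow> bool" where
  "faithful J G \<longleftrightarrow>
    (\<forall>A B C. pairwise_disjoint A B C \<longrightarrow> A \<noteq> {} \<longrightarrow> B \<noteq> {} \<longrightarrow>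
      (separated G A B C \<longleftrightarrow> (A, B, C) \<in> J))"

end

theory Submission
  imports Defs
begin

text \<open>
  Conditioning on \<open>X\<^sub>C = 1\<^sub>C\<close> turns the process into one whose kernel is the Schur complement
  \<open>S\<^sub>C\<close> of \<open>K\<^sub>C\<close> in \<open>K\<close>, so independence of \<open>A\<close> and \<open>B\<close> in the context \<open>C\<close> means that all
  entries \<open>S\<^sub>C(i, j)\<close> with \<open>i \<in> A\<close>, \<open>j \<in> B\<close> vanish, exactly as for conditional independence in a
  Gaussian vector with covariance \<open>K\<close>. The recursion
  \<open>S\<^sub>C\<^sub>\<union>\<^sub>k(i, j) = S\<^sub>C(i, j) - S\<^sub>C(i, k) S\<^sub>C(k, j) / S\<^sub>C(k, k)\<close> yields intersection and singleton
  transitivity. Intersection gives the global Markov property by descending induction on \<open>C\<close>,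
  starting from the pairwise one at \<open>C = V - {i, j}\<close>. Conversely, upward-stability
  makes the ends of every edge dependent in every context, and transitivity propagates the
  dependence along paths avoiding \<open>C\<close>. Separation is always upward-stable.
\<close>

section \<open>Principal minors as determinants\<close>

lemma principal_minor_empty [simp]: "principal_minor K {} = 1"
  by (simp add: principal_minor_def)

text \<open>Padding with the identity outside \<open>A\<close> puts a zero factor into the product
  of every permutation that moves a point outside \<open>A\<close>. This makes row operations on
  \<open>det\<close> available for principal minors.\<close>

lemma principal_minor_eq_det:
  "principal_minor K A =
    det (\<chi> i j. if i \<in> A \<and> j \<in> A then K $ i $ j else if i = j then 1 else 0)"
proof -
  let ?M = "\<chi> i j. if i \<in> A \<and> j \<in> A then K $ i $ j else if i = j then 1 else 0"
  have zero: "(\<Prod>i\<in>UNIV. ?M $ i $ p i) = 0" if p: "p permutes UNIV" "\<not> p permutes A" for p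
  proof -
    from p have "bij p" by (simp add: permutes_bij)
    have "\<exists>i. i \<notin> A \<and> p i \<noteq> i"
      using p permutes_superset[of p UNIV A] by blast
    then obtain i where "i \<notin> A" "p i \<noteq> i" by blast
    then have "?M $ i $ p i = 0" by simp
    then show ?thesis by (meson UNIV_I finite prod_zero)
  qed
  have prod: "(\<Prod>i\<in>UNIV. ?M $ i $ p i) = (\<Prod>i\<in>A. K $ i $ p i)" if p: "p permutes A" for p
  proof -
    have "(\<Prod>i\<in>UNIV. ?M $ i $ p i) = (\<Prod>i\<in>A. ?M $ i $ p i) * (\<Prod>i\<in>-A. ?M $ i $ p i)"
      by (subst prod.union_disjoint[symmetric]) auto
    also have "(\<Prod>i\<in>-A. ?M $ i $ p i) = 1"
      using p by (intro prod.neutral) (auto simp: permutes_not_in)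
    also have "(\<Prod>i\<in>A. ?M $ i $ p i) = (\<Prod>i\<in>A. K $ i $ p i)"
      using p by (intro prod.cong) (auto simp: permutes_in_image)
    finally show ?thesis by simp
  qed
  have "det ?M = (\<Sum>p | p permutes A. of_int (sign p) * (\<Prod>i\<in>UNIV. ?M $ i $ p i))"
    unfolding det_def
    using zero by (intro sum.mono_neutral_right) (auto intro: permutes_subset simp del: vec_lambda_beta)
  also have "\<dots> = principal_minor K A"
    unfolding principal_minor_def by (intro sum.cong) (auto simp: prod simp del: vec_lambda_beta)
  finally show ?thesis ..
qed

text \<open>Replacing row \<open>k\<close> by the combination of the rows with coefficients \<open>r\<close> clears it off the
  diagonal.\<close>

lemma principal_minor_insert:
  fixes K :: "real^'v^'v::finite"
  assumes k: "k \<notin> C" and rk: "r $ k = 1" and supp: "\<And>j. j \<notin> insert k C \<Longrightarrow> r $ j = 0"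
    and orth: "\<And>c. c \<in> C \<Longrightarrow> (r v* K) $ c = 0"
  shows "principal_minor K (insert k C) = (r v* K) $ k * principal_minor K C"
proof -
  define M :: "real^'v^'v" where
    "M = (\<chi> i j. if i \<in> insert k C \<and> j \<in> insert k C then K $ i $ j else if i = j then 1 else 0)"
  define N :: "real^'v^'v" where
    "N = (\<chi> i j. if i \<in> C \<and> j \<in> C then K $ i $ j else if i = j then 1 else 0)"
  define x where "x = (\<Sum>c\<in>C. r $ c *s row c M)"
  have x: "x \<in> vec.span {row j M | j. j \<noteq> k}"
    unfolding x_def using k by (intro vec.span_sum vec.span_scale vec.span_base) blast
  have row_k: "row k M + x = (r v* K) $ k *s axis k 1"
  proof (rule vec_eq_iff[THEN iffD2], rule)
    fix j
    have "(row k M + x) $ j = (\<Sum>i\<in>insert k C. r $ i * M $ i $ j)"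
      using k rk by (simp add: x_def row_def)
    \<comment> \<open>For \<open>i\<close> in \<open>insert k C\<close>, row \<open>i\<close> of
      \<open>M\<close> is zero in all columns outside \<open>insert k C\<close>.\<close>
    also have "\<dots> = (if j \<in> insert k C then \<Sum>i\<in>insert k C. r $ i * K $ i $ j else 0)"
      by (auto simp: M_def simp del: sum.insert intro!: sum.cong sum.neutral)
    also have "(\<Sum>i\<in>insert k C. r $ i * K $ i $ j) = (\<Sum>i\<in>UNIV. r $ i * K $ i $ j)"
      using supp by (intro sum.mono_neutral_left) auto
    also have "\<dots> = (r v* K) $ j"
      by (simp add: vector_matrix_mult_def mult.commute)
    finally show "(row k M + x) $ j = ((r v* K) $ k *s axis k 1) $ j"
      using orth by (auto simp: axis_def)
  qed
  have "principal_minor K (insert k C) = det M"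
    by (simp add: principal_minor_eq_det M_def)
  also have "\<dots> = det (\<chi> i. if i = k then row k M + x else row i M)"
    by (rule det_row_span[OF x, symmetric])
  also have "\<dots> = (r v* K) $ k * det (\<chi> i. if i = k then axis k 1 else row i M)"
    unfolding row_k by (rule det_row_mul)
  \<comment> \<open>Off row \<open>k\<close>, \<open>M\<close> and \<open>N\<close> differ only in
    column \<open>k\<close>. A permutation fixing \<open>k\<close> never uses that column in another
    row; one moving \<open>k\<close> meets a zero in row \<open>k\<close> of both matrices.\<close>
  also have "det (\<chi> i. if i = k then axis k 1 else row i M) = det N"
    unfolding det_def
  proof (rule sum.cong[OF refl])
    fix p assume "p \<in> {p. p permutes (UNIV :: 'v set)}"
    then have inj: "inj p" by (auto simp: permutes_inj)
    let ?L = "\<chi> i. if i = k then axis k 1 else row i M"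
    have "(\<Prod>i\<in>UNIV. ?L $ i $ p i) = (\<Prod>i\<in>UNIV. N $ i $ p i)"
    proof (cases "p k = k")
      case True
      then have "p i \<noteq> k" if "i \<noteq> k" for i using inj that by (metis injD)
      with True show ?thesis
        using k by (intro prod.cong) (auto simp: M_def N_def row_def axis_def)
    next
      case False
      then have "?L $ k $ p k = 0" "N $ k $ p k = 0"
        using k by (auto simp: N_def axis_def)
      then show ?thesis by (metis (no_types, lifting) UNIV_I finite prod_zero)
    qed
    then show "of_int (sign p) * (\<Prod>i\<in>UNIV. ?L $ i $ p i) = of_int (sign p) * (\<Prod>i\<in>UNIV. N $ i $ p i)"
      by simp
  qed
  also have "det N = principal_minor K C"
    by (simp add: principal_minor_eq_det N_def)
  finally show ?thesis .
qed

section \<open>Schur complements of a positive definite matrix\<close>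

text \<open>For the inner product \<open>x \<bullet> (K *v y)\<close>, \<open>residual K C i\<close> is the component of the \<open>i\<close>-th unit
  vector orthogonal to the unit vectors indexed by \<open>C\<close>. Off \<open>C\<close>, \<open>schur K C\<close> is the Schur
  complement of \<open>K\<^sub>C\<close> in \<open>K\<close>.\<close>

definition residual :: "real^'v^'v \<Rightarrow> 'v::finite set \<Rightarrow> 'v \<Rightarrow> real^'v" where
  "residual K C i =
    (SOME r. (\<forall>j. j \<notin> C \<longrightarrow> r $ j = axis i 1 $ j) \<and> (\<forall>c\<in>C. (K *v r) $ c = 0))"

definition schur :: "real^'v^'v \<Rightarrow> 'v::finite set \<Rightarrow> 'v \<Rightarrow> 'v \<Rightarrow> real" where
  "schur K C i j = (K *v residual K C i) $ j"

context
  fixes K :: "real^'v^'v::finite"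
  assumes pd: "positive_definite K"
begin

lemma form_pos: "x \<noteq> 0 \<Longrightarrow> x \<bullet> (K *v x) > 0"
  using pd by (simp add: positive_definite_def)

lemma vector_matrix_mult_commute: "x v* K = K *v x"
  using pd by (metis positive_definite_def vector_transpose_matrix)

lemma form_sym: "x \<bullet> (K *v y) = y \<bullet> (K *v x)"
  by (metis dot_lmul_matrix inner_commute vector_matrix_mult_commute)

text \<open>The difference \<open>r - s\<close> is supported on \<open>C\<close>, while its image
  under \<open>K\<close> vanishes there, so the quadratic form is zero at it.\<close>

lemma residual_unique:
  assumes "\<And>j. j \<notin> C \<Longrightarrow> r $ j = s $ j" "\<And>c. c \<in> C \<Longrightarrow> (K *v r) $ c = 0"
    "\<And>c. c \<in> C \<Longrightarrow> (K *v s) $ c = 0"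
  shows "r = s"
proof (rule ccontr)
  assume "r \<noteq> s"
  then have "(r - s) \<bullet> (K *v (r - s)) > 0" by (intro form_pos) simp
  moreover have "(r - s) $ j * (K *v (r - s)) $ j = 0" for j
    using assms by (cases "j \<in> C") (auto simp: matrix_vector_mult_diff_distrib)
  then have "(r - s) \<bullet> (K *v (r - s)) = 0"
    unfolding inner_vec_def by (intro sum.neutral) auto
  ultimately show False by simp
qed

text \<open>One Gram-Schmidt step for each element of \<open>C\<close>.\<close>

lemma residual_exists:
  "\<exists>r. (\<forall>j. j \<notin> C \<longrightarrow> r $ j = axis i 1 $ j) \<and> (\<forall>c\<in>C. (K *v r) $ c = 0)"
proof (induction C arbitrary: i rule: finite_induct[OF finite])
  case 1
  show ?case by blast
next
  case (2 k C)
  obtain r where r: "\<And>j. j \<notin> C \<Longrightarrow> r $ j = axis i 1 $ j" "\<And>c. c \<in> C \<Longrightarrow> (K *v r) $ c = 0"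
    using 2 by metis
  obtain s where s: "\<And>j. j \<notin> C \<Longrightarrow> s $ j = axis k 1 $ j" "\<And>c. c \<in> C \<Longrightarrow> (K *v s) $ c = 0"
    using 2 by metis
  have "s $ k = 1" using s 2 by simp
  then have "s \<noteq> 0" by auto
  have "s \<bullet> (K *v s) = (\<Sum>j\<in>UNIV. if j = k then (K *v s) $ k else 0)"
    unfolding inner_vec_def
  proof (rule sum.cong[OF refl])
    fix j
    show "s $ j \<bullet> (K *v s) $ j = (if j = k then (K *v s) $ k else 0)"
      using s[of j] \<open>s $ k = 1\<close> by (cases "j \<in> C") (auto simp: axis_def)
  qed
  then have pos: "(K *v s) $ k > 0"
    using form_pos[OF \<open>s \<noteq> 0\<close>] by simp
  \<comment> \<open>The coefficient that cancels coordinate \<open>k\<close> of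
    \<open>K *v r\<close>. The denominator is positive because it equals the form at
    \<open>s\<close>.\<close>
  let ?a = "(K *v r) $ k / (K *v s) $ k"
  have "K *v (r - ?a *\<^sub>R s) = K *v r - ?a *\<^sub>R (K *v s)"
    by (simp add: matrix_vector_mult_diff_distrib matrix_vector_mult_scaleR)
  then show ?case
    using r s pos by (intro exI[of _ "r - ?a *\<^sub>R s"]) (auto simp: axis_def)
qed

lemma residual_off: "j \<notin> C \<Longrightarrow> residual K C i $ j = axis i 1 $ j"
  and residual_on: "c \<in> C \<Longrightarrow> (K *v residual K C i) $ c = 0"
  using someI_ex[OF residual_exists[of C i]] unfolding residual_def by blast+

text \<open>The vector \<open>K *v residual K C i\<close> vanishes on \<open>C\<close>, and off
  \<open>C\<close> the residual of \<open>j\<close> agrees with a unit vector, so at most coordinate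
  \<open>j\<close> contributes. Symmetry and positivity of the Schur complement are read off from
  this form.\<close>

lemma schur_form: "schur K C i j = residual K C j \<bullet> (K *v residual K C i)"
proof -
  have "residual K C j \<bullet> (K *v residual K C i) =
      (\<Sum>l\<in>UNIV. if l = j then (K *v residual K C i) $ j else 0)"
    unfolding inner_vec_def
  proof (rule sum.cong[OF refl])
    fix l
    show "residual K C j $ l \<bullet> (K *v residual K C i) $ l =
        (if l = j then (K *v residual K C i) $ j else 0)"
      using residual_on[of l C i] residual_off[of l C j]
      by (cases "l \<in> C") (auto simp: axis_def)
  qed
  then show ?thesis by (simp add: schur_def)
qed

lemma schur_sym: "schur K C i j = schur K C j i"
  by (simp add: schur_form form_sym)

lemma schur_pos:
  assumes "k \<notin> C"
  shows "schur K C k k > 0"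
proof -
  have "residual K C k $ k \<noteq> 0" using assms by (simp add: residual_off)
  then show ?thesis unfolding schur_form by (intro form_pos) auto
qed

text \<open>Enlarging \<open>C\<close> by \<open>k\<close> subtracts from the residual of
  \<open>i\<close> its projection onto the residual of \<open>k\<close>; uniqueness identifies the
  result.\<close>

lemma schur_insert:
  assumes "k \<notin> C"
  shows "schur K (insert k C) i j = schur K C i j - schur K C i k * schur K C k j / schur K C k k"
proof -
  let ?a = "schur K C i k / schur K C k k"
  have *: "K *v (residual K C i - ?a *\<^sub>R residual K C k) =
      K *v residual K C i - ?a *\<^sub>R (K *v residual K C k)"
    by (simp add: matrix_vector_mult_diff_distrib matrix_vector_mult_scaleR)
  have "residual K (insert k C) i = residual K C i - ?a *\<^sub>R residual K C k"
    by (rule residual_unique[of "insert k C"])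
      (use schur_pos[OF assms] in \<open>auto simp: residual_off residual_on matrix_vector_mult_diff_distrib
        matrix_vector_mult_scaleR schur_def axis_def\<close>)
  then show ?thesis
    by (simp add: schur_def[of K "insert k C"] *) (simp add: schur_def)
qed

lemma minor_insert:
  "k \<notin> C \<Longrightarrow> principal_minor K (insert k C) = schur K C k k * principal_minor K C"
  using principal_minor_insert[of k C "residual K C k" K]
  by (simp add: residual_off residual_on vector_matrix_mult_commute schur_def axis_def)

lemma minor_pos: "principal_minor K C > 0"
  by (induction C rule: finite_induct[OF finite]) (auto simp: minor_insert schur_pos)

text \<open>After division by positive minors, the equation says that adding \<open>j\<close> to the
  context leaves the diagonal entry at \<open>i\<close> unchanged. The change is the square of
  \<open>schur K C i j\<close> over a positive number.\<close>

lemma minor_factor_iff: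
  assumes "i \<noteq> j" "i \<notin> C" "j \<notin> C"
  shows "principal_minor K (insert i (insert j C)) * principal_minor K C =
      principal_minor K (insert i C) * principal_minor K (insert j C) \<longleftrightarrow> schur K C i j = 0"
proof -
  have "schur K (insert j C) i i = schur K C i i - schur K C i j ^ 2 / schur K C j j"
    using assms by (simp add: schur_insert schur_sym[of C j i] power2_eq_square)
  then have "schur K (insert j C) i i = schur K C i i \<longleftrightarrow> schur K C i j = 0"
    using schur_pos[of j C] assms by auto
  then show ?thesis
    using assms minor_pos[of C] schur_pos[of j C] by (simp add: minor_insert)
qed

lemma schur_insert_eq_0:
  assumes "k \<notin> C" "schur K C i j = 0" "schur K C i k = 0 \<or> schur K C k j = 0"
  shows "schur K (insert k C) i j = 0"
  using assms by (auto simp: schur_insert)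

lemma schur_transitivity:
  assumes "k \<notin> C" "schur K C i j = 0" "schur K (insert k C) i j = 0"
  shows "schur K C i k = 0 \<or> schur K C k j = 0"
  using assms schur_pos[of k C] by (simp add: schur_insert)

text \<open>The two vanishing entries give a homogeneous linear system in
  \<open>schur K C i j\<close> and \<open>schur K C i k\<close>. Its determinant is, up to sign, the
  minor of the Schur complement on \<open>j\<close> and \<open>k\<close>.\<close>

lemma schur_intersection:
  assumes "j \<notin> C" "k \<notin> C" "j \<noteq> k"
    and "schur K (insert k C) i j = 0" "schur K (insert j C) i k = 0"
  shows "schur K C i j = 0"
proof -
  have pos: "schur K C j j > 0" "schur K C k k > 0" using assms by (auto simp: schur_pos)
  have "schur K (insert k C) j j > 0" using assms by (simp add: schur_pos)
  \<comment> \<open>This minor is the product of \<open>schur K C k k\<close> and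
    \<open>schur K (insert k C) j j\<close>.\<close>
  then have disc: "schur K C j j * schur K C k k - schur K C j k ^ 2 > 0"
    using assms pos by (simp add: schur_insert schur_sym[of C k j] field_simps power2_eq_square)
  have "schur K C i j * schur K C k k = schur K C i k * schur K C j k"
    using assms pos by (simp add: schur_insert schur_sym[of C k j] field_simps)
  moreover have "schur K C i k * schur K C j j = schur K C i j * schur K C j k"
    using assms pos by (simp add: schur_insert field_simps)
  ultimately have "schur K C i j * (schur K C j j * schur K C k k - schur K C j k ^ 2) = 0"
    by algebra
  then show ?thesis using disc by simp
qed

section \<open>The inverse matrix and the largest contexts\<close>

lemma invertible_K: "K ** matrix_inv K = mat 1" "matrix_inv K ** K = mat 1"
proof -
  have "\<forall>x. K *v x = 0 \<longrightarrow> x = 0"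
    using form_pos by force
  then have "invertible K"
    by (simp add: invertible_left_inverse matrix_left_invertible_ker)
  then have "\<exists>B. K ** B = mat 1 \<and> B ** K = mat 1"
    by (simp add: invertible_def)
  from someI_ex[OF this] show "K ** matrix_inv K = mat 1" "matrix_inv K ** K = mat 1"
    by (auto simp: matrix_inv_def)
qed

lemma inverse_diag_pos: "matrix_inv K $ i $ i > 0"
proof -
  let ?y = "matrix_inv K *v axis i 1"
  have Ky: "K *v ?y = axis i 1"
    by (simp add: matrix_vector_mul_assoc invertible_K)
  then have "?y \<noteq> 0" by (metis axis_eq_0_iff matrix_vector_mult_0_right zero_neq_one)
  from form_pos[OF this] show ?thesis
    unfolding Ky by (simp add: inner_axis matrix_vector_mul_component row_def[symmetric])
qed

text \<open>For the context \<open>- {i, j}\<close>, \<open>K\<close> maps the residual of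
  \<open>j\<close> to a combination of two unit vectors. Applying the inverse and reading coordinate
  \<open>i\<close>, where the residual is 0, relates the two entries through positive diagonal
  factors.\<close>

lemma schur_eq_0_iff_inverse:
  assumes "i \<noteq> j"
  shows "schur K (- {i, j}) i j = 0 \<longleftrightarrow> matrix_inv K $ i $ j = 0"
proof -
  let ?C = "- {i, j}" and ?r = "residual K (- {i, j}) j"
  have "K *v ?r = schur K ?C j i *\<^sub>R axis i 1 + schur K ?C j j *\<^sub>R axis j 1"
  proof (rule vec_eq_iff[THEN iffD2], rule)
    fix l
    show "(K *v ?r) $ l = (schur K ?C j i *\<^sub>R axis i 1 + schur K ?C j j *\<^sub>R axis j 1) $ l"
      using residual_on[of l ?C j] assms by (auto simp: axis_def schur_def)
  qed
  then have "?r = matrix_inv K *v (schur K ?C j i *\<^sub>R axis i 1 + schur K ?C j j *\<^sub>R axis j 1)"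
    by (metis invertible_K(2) matrix_vector_mul_assoc matrix_vector_mul_lid)
  then have "?r $ i = schur K ?C j i * matrix_inv K $ i $ i + schur K ?C j j * matrix_inv K $ i $ j"
    by (simp add: matrix_vector_right_distrib matrix_vector_mult_scaleR matrix_vector_mult_basis column_def)
  moreover have "?r $ i = 0" using assms by (simp add: residual_off axis_def)
  ultimately have "schur K ?C i j * matrix_inv K $ i $ i = - (schur K ?C j j * matrix_inv K $ i $ j)"
    by (simp add: schur_sym[of ?C j i])
  then show ?thesis
    using schur_pos[of j ?C] inverse_diag_pos[of i] by auto
qed

end

section \<open>Independence of binary vectors tested on all-ones events\<close>

lemma Int_stable_cylinders: "Int_stable {{x. \<forall>v\<in>D. x v} | D. D \<subseteq> A}"
proof (rule Int_stableI)
  fix a b assume "a \<in> {{x. \<forall>v\<in>D. x v} | D. D \<subseteq> A}" "b \<in> {{x. \<forall>v\<in>D. x v} | D. D \<subseteq> A}"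
  then obtain D E where "a = {x. \<forall>v\<in>D. x v}" "b = {x. \<forall>v\<in>E. x v}" "D \<subseteq> A" "E \<subseteq> A"
    by blast
  then have "a \<inter> b = {x. \<forall>v\<in>D \<union> E. x v}" "D \<union> E \<subseteq> A" by auto
  then show "a \<inter> b \<in> {{x. \<forall>v\<in>D. x v} | D. D \<subseteq> A}" by blast
qed

text \<open>Complements of cylinders fix coordinates to 0, so every prescribed pattern on
  \<open>A\<close> is a finite intersection of generated events, and any event about
  \<open>A\<close> is a finite union of patterns.\<close>

lemma restrict_vimage_in_sigma_cylinders:
  fixes A :: "'v::finite set"
  shows "(\<lambda>x. restrict x A) -` Z \<in> sigma_sets UNIV {{x. \<forall>v\<in>D. x v} | D. D \<subseteq> A}"
    (is "_ \<in> ?S")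
proof -
  interpret sigma_algebra UNIV ?S by (rule sigma_algebra_sigma_sets) simp
  have true: "{y. y v} \<in> ?S" if "v \<in> A" for v
    using that by (intro sigma_sets.Basic CollectI exI[of _ "{v}"]) auto
  have coord: "{y. y v = x v} \<in> ?S" if "v \<in> A" for v and x :: "'v \<Rightarrow> bool"
  proof (cases "x v")
    case False
    then have "{y. y v = x v} = UNIV - {y. y v}" by auto
    with compl_sets[OF true[OF that]] show ?thesis by (simp only:)
  next
    case True
    then have "{y. y v = x v} = {y. y v}" by auto
    with true[OF that] show ?thesis by (simp only:)
  qed
  have point: "(\<Inter>v\<in>A. {y. y v = x v}) \<in> ?S" for x
  proof (cases "A = {}")
    case True
    then show ?thesis by (simp add: sigma_sets_top)
  next
    case False
    then show ?thesis by (intro finite_INT coord) simp_all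
  qed
  have "(\<lambda>x. restrict x A) -` Z =
      (\<Union>x\<in>{x. restrict x A \<in> Z}. \<Inter>v\<in>A. {y. y v = x v})" (is "_ = ?U")
  proof (rule set_eqI)
    fix y :: "'v \<Rightarrow> bool"
    show "y \<in> (\<lambda>x. restrict x A) -` Z \<longleftrightarrow> y \<in> ?U"
    proof
      assume "y \<in> (\<lambda>x. restrict x A) -` Z"
      then show "y \<in> ?U" by (intro UN_I[of y]) auto
    next
      assume "y \<in> ?U"
      then obtain x where x: "restrict x A \<in> Z" "\<forall>v\<in>A. y v = x v" by auto
      then have "restrict y A = restrict x A" by (auto simp: restrict_def)
      with x show "y \<in> (\<lambda>x. restrict x A) -` Z" by simp
    qed
  qed
  also have "\<dots> \<in> ?S"
    by (intro finite_UN point finite)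
  finally show ?thesis .
qed

lemma indep_var_restrict_iff:
  fixes Q :: "('v::finite \<Rightarrow> bool) pmf"
  shows "prob_space.indep_var (measure_pmf Q)
      (count_space UNIV) (\<lambda>x. restrict x A) (count_space UNIV) (\<lambda>x. restrict x B) \<longleftrightarrow>
    (\<forall>D E. D \<subseteq> A \<longrightarrow> E \<subseteq> B \<longrightarrow>
      measure_pmf.prob Q {x. \<forall>v\<in>D \<union> E. x v} =
      measure_pmf.prob Q {x. \<forall>v\<in>D. x v} * measure_pmf.prob Q {x. \<forall>v\<in>E. x v})"
    (is "?I \<longleftrightarrow> ?F")
proof -
  note prob_space = prob_space_measure_pmf[of Q]
  show ?thesis
  proof
    assume I: ?I
    show ?F
    proof (intro allI impI)
      fix D E assume D: "D \<subseteq> A" and E: "E \<subseteq> B"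
      \<comment> \<open>Coordinates in \<open>D\<close> survive restriction to \<open>A\<close>, so
        the cylinder is its own preimage; likewise for \<open>E\<close> and
        \<open>B\<close>.\<close>
      have "(\<lambda>x. restrict x A) -` {x. \<forall>v\<in>D. x v} = {x. \<forall>v\<in>D. x v}"
        "(\<lambda>x. restrict x B) -` {x. \<forall>v\<in>E. x v} = {x. \<forall>v\<in>E. x v}"
        "(\<lambda>x. (restrict x A, restrict x B)) -` ({x. \<forall>v\<in>D. x v} \<times> {x. \<forall>v\<in>E. x v}) =
          {x. \<forall>v\<in>D \<union> E. x v}"
        using D E by (auto simp: subset_iff)
      then show "measure_pmf.prob Q {x. \<forall>v\<in>D \<union> E. x v} =
          measure_pmf.prob Q {x. \<forall>v\<in>D. x v} * measure_pmf.prob Q {x. \<forall>v\<in>E. x v}"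
        using prob_space.indep_varD[OF prob_space I, of "{x. \<forall>v\<in>D. x v}" "{x. \<forall>v\<in>E. x v}"] by simp
    qed
  next
    assume F: ?F
    let ?cyl = "\<lambda>A. {{x. \<forall>v\<in>D. x v} | D. D \<subseteq> A} :: ('v \<Rightarrow> bool) set set"
    \<comment> \<open>Cylinders are closed under intersection, so independence on them extends to
      the generated sigma-algebras.\<close>
    have "prob_space.indep_set (measure_pmf Q) (?cyl A) (?cyl B)"
    proof (rule prob_space.indep_setI[OF prob_space])
      fix a b assume "a \<in> ?cyl A" "b \<in> ?cyl B"
      then obtain D E where "a = {x. \<forall>v\<in>D. x v}" "b = {x. \<forall>v\<in>E. x v}" "D \<subseteq> A" "E \<subseteq> B"
        by blast
      moreover from this have "a \<inter> b = {x. \<forall>v\<in>D \<union> E. x v}" by auto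
      ultimately show "measure_pmf.prob Q (a \<inter> b) = measure_pmf.prob Q a * measure_pmf.prob Q b"
        using F by simp
    qed auto
    then have *: "prob_space.indep_set (measure_pmf Q)
        (sigma_sets UNIV (?cyl A)) (sigma_sets UNIV (?cyl B))"
      using prob_space.indep_set_sigma_sets[OF prob_space, of "?cyl A" "?cyl B"]
        Int_stable_cylinders by auto
    have sub: "sigma_sets UNIV {(\<lambda>x. restrict x A) -` Z | Z. True} \<subseteq> sigma_sets UNIV (?cyl A)"
      for A :: "'v set"
      using restrict_vimage_in_sigma_cylinders[of A] by (intro sigma_sets_mono) auto
    show ?I
      unfolding prob_space.indep_var_eq[OF prob_space]
      using * sub[of A] sub[of B]
      by (auto simp: prob_space.indep_sets2_eq[OF prob_space] subset_iff)
  qed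
qed

text \<open>Telescoping: the local identities are multiplied together and the common positive
  factors cancelled, first while one side grows against a single \<open>j\<close>, then while the
  other side grows from the empty set.\<close>

lemma pairwise_factor_imp_union_factor:
  fixes f :: "'v::finite set \<Rightarrow> real"
  assumes pos: "\<And>D. f D > 0" and disj: "A \<inter> B = {}"
    and pair: "\<And>i j D. i \<in> A \<Longrightarrow> j \<in> B \<Longrightarrow> i \<notin> D \<Longrightarrow> j \<notin> D \<Longrightarrow> D \<subseteq> A \<union> B \<Longrightarrow>
      f (insert i (insert j D)) * f D = f (insert i D) * f (insert j D)"
  shows "f (A \<union> B) * f {} = f A * f B"
proof -
  have single: "f (E \<union> insert j D) * f D = f (E \<union> D) * f (insert j D)"
    if "E \<subseteq> A" "j \<in> B" "j \<notin> D" "D \<subseteq> B" for E j D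
    using finite[of E] that(1)
  proof (induction E rule: finite_induct)
    case (insert i E)
    then have "i \<notin> E \<union> D" "j \<notin> E \<union> D" using that disj by auto
    then have "f (insert i (insert j (E \<union> D))) * f (E \<union> D) =
        f (insert i (E \<union> D)) * f (insert j (E \<union> D))"
      using insert that by (intro pair) auto
    moreover have "f (insert j (E \<union> D)) * f D = f (E \<union> D) * f (insert j D)"
      using insert by simp
    ultimately have "f (insert i (insert j (E \<union> D))) * f D * f (E \<union> D) =
        f (insert i (E \<union> D)) * f (insert j D) * f (E \<union> D)"
      by algebra
    then show ?case using pos[of "E \<union> D"] by (simp add: insert_commute)
  qed simp
  have "f (A \<union> D) * f {} = f A * f D" if "D \<subseteq> B" for D
    using finite[of D] that
  proof (induction D rule: finite_induct)
    case (insert j D)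
    have "f (A \<union> insert j D) * f D = f (A \<union> D) * f (insert j D)"
      using insert by (intro single) auto
    moreover have "f (A \<union> D) * f {} = f A * f D" using insert by simp
    ultimately have "f (A \<union> insert j D) * f {} * f D = f A * f (insert j D) * f D"
      by algebra
    then show ?case using pos[of D] by simp
  qed simp
  then show ?thesis by simp
qed

section \<open>Paths and separation as reachability\<close>

abbreviation connected_avoiding :: "('v \<Rightarrow> 'v \<Rightarrow> bool) \<Rightarrow> 'v set \<Rightarrow> 'v \<Rightarrow> 'v \<Rightarrow> bool" where
  "connected_avoiding G C \<equiv> (\<lambda>x y. G x y \<and> x \<notin> C \<and> y \<notin> C)\<^sup>*\<^sup>*"

text \<open>The closure is reflexive even at vertices of \<open>C\<close>, whence the assumption on
  \<open>a\<close>.\<close>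

lemma ex_path_iff_connected_avoiding:
  assumes "a \<notin> C"
  shows "(\<exists>p. is_path G a p b \<and> set p \<inter> C = {}) \<longleftrightarrow> connected_avoiding G C a b"
proof
  assume "\<exists>p. is_path G a p b \<and> set p \<inter> C = {}"
  then obtain p where "p \<noteq> []" "hd p = a" "last p = b" "successively G p" "set p \<inter> C = {}"
    by (auto simp: is_path_def)
  then show "connected_avoiding G C a b"
  proof (induction p arbitrary: a)
    case (Cons x p)
    show ?case
    proof (cases "p = []")
      case False
      then have "connected_avoiding G C (hd p) b" using Cons by (auto simp: successively_Cons)
      moreover have "G a (hd p)" "a \<notin> C" "hd p \<notin> C"
        using Cons False by (auto simp: successively_Cons dest: list.set_sel(1))
      ultimately show ?thesis by (metis (no_types, lifting) converse_rtranclp_into_rtranclp)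
    qed (use Cons in auto)
  qed simp
next
  assume "connected_avoiding G C a b"
  then show "\<exists>p. is_path G a p b \<and> set p \<inter> C = {}"
  proof (induction rule: rtranclp_induct)
    case base
    show ?case using assms by (intro exI[of _ "[a]"]) (auto simp: is_path_def)
  next
    case (step y z)
    then obtain p where p: "is_path G a p y" "set p \<inter> C = {}" by blast
    show ?case
    proof (cases "z \<in> set p")
      case True
      \<comment> \<open>The path already visits \<open>z\<close>; cutting it there keeps the
        vertices distinct.\<close>
      then obtain q r where "p = q @ z # r" by (meson split_list)
      with p show ?thesis
        by (intro exI[of _ "q @ [z]"])
          (auto simp: is_path_def successively_append_iff hd_append split: if_splits)
    next
      case False
      with p step show ?thesis
        by (intro exI[of _ "p @ [z]"]) (auto simp: is_path_def successively_append_iff)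
    qed
  qed
qed

lemma separated_iff:
  assumes "A \<inter> C = {}"
  shows "separated G A B C \<longleftrightarrow> (\<forall>a\<in>A. \<forall>b\<in>B. \<not> connected_avoiding G C a b)"
  unfolding separated_def using assms ex_path_iff_connected_avoiding[of _ C G] by blast

lemma separated_mono: "separated G A B C \<Longrightarrow> C \<subseteq> D \<Longrightarrow> separated G A B D"
  unfolding separated_def by blast

section \<open>Contextual independence in a determinantal point process\<close>

context
  fixes P :: "('v::finite \<Rightarrow> bool) pmf" and K :: "real^'v^'v"
  assumes dpp: "dpp P K"
begin

lemma dpp_positive_definite: "positive_definite K"
  using dpp by (simp add: dpp_def)

lemma dpp_prob: "measure_pmf.prob P {x. \<forall>v\<in>A. x v} = principal_minor K A"
  using dpp by (cases "A = {}") (auto simp: dpp_def)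

lemma dpp_cond_prob:
  "measure_pmf.prob (cond_pmf P {x. \<forall>v\<in>C. x v}) {x. \<forall>v\<in>D. x v} =
    principal_minor K (C \<union> D) / principal_minor K C"
proof -
  have pos: "measure_pmf.prob P {x. \<forall>v\<in>C. x v} > 0"
    by (simp add: dpp_prob minor_pos[OF dpp_positive_definite])
  \<comment> \<open>\<open>cond_pmf\<close> is specified only for events that meet the
    support.\<close>
  then have "set_pmf P \<inter> {x. \<forall>v\<in>C. x v} \<noteq> {}"
    by (metis less_irrefl measure_pmf_zero_iff)
  then have "measure_pmf.prob (cond_pmf P {x. \<forall>v\<in>C. x v}) {x. \<forall>v\<in>D. x v} =
      measure_pmf.prob P ({x. \<forall>v\<in>C. x v} \<inter> {x. \<forall>v\<in>D. x v}) / measure_pmf.prob P {x. \<forall>v\<in>C. x v}"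
    using pos by (simp add: cond_pmf.rep_eq measure_pmf.emeasure_eq_measure)
  also have "{x. \<forall>v\<in>C. x v} \<inter> {x. \<forall>v\<in>D. x v} = {x. \<forall>v\<in>C \<union> D. x v}" by auto
  finally show ?thesis unfolding dpp_prob .
qed

text \<open>Each added \<open>k\<close> lies in \<open>A\<close> or in \<open>B\<close>, so one
  factor of the correction term in \<open>schur_insert\<close> is already zero.\<close>

lemma schur_eq_0_mono:
  assumes "\<And>i j. i \<in> A \<Longrightarrow> j \<in> B \<Longrightarrow> schur K C i j = 0" "D \<subseteq> A \<union> B" "D \<inter> C = {}"
    "i \<in> A" "j \<in> B"
  shows "schur K (C \<union> D) i j = 0"
  using finite[of D] assms(2-)
proof (induction D arbitrary: i j rule: finite_induct)
  case empty
  then show ?case using assms(1) by simp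
next
  case (insert k D)
  then have "schur K (C \<union> D) i j = 0" "schur K (C \<union> D) i k = 0 \<or> schur K (C \<union> D) k j = 0"
    by auto
  then show ?case
    using schur_insert_eq_0[OF dpp_positive_definite, of k "C \<union> D" i j] insert by auto
qed

text \<open>Conditional inclusion probabilities are quotients of minors, so independence is a
  factorization of minors. Singletons already force the entries to vanish; conversely, the entries
  stay zero in all intermediate contexts, and the local factorizations telescope.\<close>

lemma context_indep_iff:
  assumes "pairwise_disjoint A B C"
  shows "context_indep P A B C \<longleftrightarrow> (\<forall>i\<in>A. \<forall>j\<in>B. schur K C i j = 0)"
proof -
  let ?f = "\<lambda>D. principal_minor K (C \<union> D)"
  have disj: "A \<inter> B = {}" "A \<inter> C = {}" "B \<inter> C = {}"
    using assms by (auto simp: pairwise_disjoint_def)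
  have pos: "?f D > 0" for D by (rule minor_pos[OF dpp_positive_definite])
  have "context_indep P A B C \<longleftrightarrow>
      (\<forall>D E. D \<subseteq> A \<longrightarrow> E \<subseteq> B \<longrightarrow> ?f (D \<union> E) * ?f {} = ?f D * ?f E)"
    unfolding context_indep_def indep_var_restrict_iff dpp_cond_prob
    using pos[of "{}"] by (simp add: field_simps)
  also have "\<dots> \<longleftrightarrow> (\<forall>i\<in>A. \<forall>j\<in>B. schur K C i j = 0)"
  proof (intro iffI ballI allI impI)
    fix i j assume *: "\<forall>D E. D \<subseteq> A \<longrightarrow> E \<subseteq> B \<longrightarrow> ?f (D \<union> E) * ?f {} = ?f D * ?f E"
      and ij: "i \<in> A" "j \<in> B"
    have "?f ({i} \<union> {j}) * ?f {} = ?f {i} * ?f {j}"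
      using *[rule_format, of "{i}" "{j}"] ij by blast
    moreover from ij disj have "i \<noteq> j" "i \<notin> C" "j \<notin> C" by auto
    ultimately show "schur K C i j = 0"
      using minor_factor_iff[OF dpp_positive_definite, of i j C] by (simp add: insert_commute)
  next
    fix D E assume *: "\<forall>i\<in>A. \<forall>j\<in>B. schur K C i j = 0" and DE: "D \<subseteq> A" "E \<subseteq> B"
    show "?f (D \<union> E) * ?f {} = ?f D * ?f E"
    proof (rule pairwise_factor_imp_union_factor[where f = ?f, OF pos])
      show "D \<inter> E = {}" using DE disj by blast
    next
      fix i j F assume ij: "i \<in> D" "j \<in> E" "i \<notin> F" "j \<notin> F" "F \<subseteq> D \<union> E"
      have "F \<inter> C = {}" using ij DE disj by blast
      then have "schur K (C \<union> F) i j = 0"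
        using * DE disj ij by (intro schur_eq_0_mono[of A B]) auto
      moreover have "i \<noteq> j" "i \<notin> C \<union> F" "j \<notin> C \<union> F" using ij DE disj by auto
      ultimately show "?f (insert i (insert j F)) * ?f F = ?f (insert i F) * ?f (insert j F)"
        using minor_factor_iff[OF dpp_positive_definite, of i j "C \<union> F"] by simp
    qed
  qed
  finally show ?thesis .
qed

lemma in_context_indep_model_iff:
  "(A, B, C) \<in> context_indep_model P \<longleftrightarrow>
    pairwise_disjoint A B C \<and> (\<forall>i\<in>A. \<forall>j\<in>B. schur K C i j = 0)"
  unfolding context_indep_model_def using context_indep_iff by auto

lemma G_u_iff: "G_u K i j \<longleftrightarrow> i \<noteq> j \<and> schur K (- {i, j}) i j \<noteq> 0"
  using schur_eq_0_iff_inverse[OF dpp_positive_definite, of i j] by (auto simp: G_u_def)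

section \<open>The global Markov property and its converse under upward-stability\<close>

lemma global_markov:
  assumes "i \<noteq> j" "i \<notin> C" "j \<notin> C" "\<not> connected_avoiding (G_u K) C i j"
  shows "schur K C i j = 0"
  using assms
proof (induction "card (- C)" arbitrary: C i j rule: less_induct)
  case less
  have mono: "\<not> connected_avoiding (G_u K) (insert l C) i' j'"
    if "\<not> connected_avoiding (G_u K) C i' j'" for l i' j'
    using that rtranclp_mono[of "\<lambda>x y. G_u K x y \<and> x \<notin> insert l C \<and> y \<notin> insert l C"
        "\<lambda>x y. G_u K x y \<and> x \<notin> C \<and> y \<notin> C"] by blast
  have smaller: "card (- insert l C) < card (- C)" if "l \<notin> C" for l
    using that by (intro psubset_card_mono) auto
  show ?case
  proof (cases "C = - {i, j}")
    case True
    have "\<not> G_u K i j" using less.prems by blast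
    then show ?thesis using True less.prems G_u_iff by simp
  next
    case False
    then obtain k where k: "k \<notin> C" "k \<noteq> i" "k \<noteq> j" using less.prems by blast
    have ij: "schur K (insert k C) i j = 0"
      using less.prems k by (intro less.hyps smaller mono) auto
    \<comment> \<open>If \<open>k\<close> were connected to both \<open>i\<close> and
      \<open>j\<close>, these would be connected through it. In either case intersection removes
      \<open>k\<close> from the context.\<close>
    have "\<not> connected_avoiding (G_u K) C i k \<or> \<not> connected_avoiding (G_u K) C k j"
      using less.prems(4) by (meson rtranclp_trans)
    then show ?thesis
    proof
      assume "\<not> connected_avoiding (G_u K) C i k"
      then have "schur K (insert j C) i k = 0"
        using less.prems k by (intro less.hyps smaller mono) auto
      then show ?thesis
        using schur_intersection[OF dpp_positive_definite, of j C k i] ij k less.prems by simp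
    next
      assume "\<not> connected_avoiding (G_u K) C k j"
      then have "schur K (insert i C) k j = 0"
        using less.prems k by (intro less.hyps smaller mono) auto
      then show ?thesis
        using schur_intersection[OF dpp_positive_definite, of i C k j] ij k less.prems
        by (simp add: schur_sym[OF dpp_positive_definite, of _ j])
    qed
  qed
qed

lemma upward_stable_schur:
  assumes "upward_stable (context_indep_model P)"
    and "i \<noteq> j" "i \<notin> D" "j \<notin> D" "C \<subseteq> D" "schur K C i j = 0"
  shows "schur K D i j = 0"
proof -
  have "schur K (C \<union> E) i j = 0" if "E \<subseteq> D" for E
    using finite[of E] that
  proof (induction E rule: finite_induct)
    case (insert k E)
    have "({i}, {j}, C \<union> E) \<in> context_indep_model P"
      using insert assms by (auto simp: in_context_indep_model_iff pairwise_disjoint_def)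
    moreover have "k \<in> UNIV - {i, j}" "C \<union> E \<subseteq> UNIV - {i, j}" using insert assms by auto
    ultimately have "({i}, {j}, (C \<union> E) \<union> {k}) \<in> context_indep_model P"
      using assms unfolding upward_stable_def by blast
    then show ?case by (simp add: in_context_indep_model_iff)
  qed (use assms in simp)
  from this[of D] show ?thesis using assms by (simp add: Un_absorb1)
qed

text \<open>Induction along a walk from \<open>i\<close>; the alternative \<open>j = i\<close>
  covers the empty walk and walks returning to \<open>i\<close>.\<close>

lemma connected_avoiding_imp_dependent:
  assumes "upward_stable (context_indep_model P)" "i \<notin> C" "connected_avoiding (G_u K) C i j"
  shows "j = i \<or> schur K C i j \<noteq> 0"
  using assms(3)
proof (induction rule: rtranclp_induct)
  case (step y z)
  \<comment> \<open>A zero here would persist up to the context \<open>- {y, z}\<close>,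
    contradicting adjacency.\<close>
  have edge: "schur K C y z \<noteq> 0"
    using upward_stable_schur[OF assms(1), of y z "- {y, z}" C] step G_u_iff[of y z] by auto
  show ?case
  proof (cases "z = i \<or> y = i")
    case False
    then have "\<not> (schur K C i y = 0 \<or> schur K C y z = 0)" "z \<noteq> y"
      using step edge by (auto simp: G_u_def)
    then have "\<not> (schur K C i z = 0 \<and> schur K (insert y C) i z = 0)"
      using schur_transitivity[OF dpp_positive_definite, of y C i z] step by blast
    \<comment> \<open>A zero in context \<open>C\<close> would persist in \<open>insert y C\<close>,
      and transitivity excludes both being zero.\<close>
    then show ?thesis
      using upward_stable_schur[OF assms(1), of i z "insert y C" C] step assms(2) False \<open>z \<noteq> y\<close>
      by auto
  qed (use edge in auto)
qed simp

end

theorem proposition8: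
  fixes P :: "('v::finite \<Rightarrow> bool) pmf" and K :: "real^'v^'v"
  assumes "dpp P K"
  shows "faithful (context_indep_model P) (G_u K) \<longleftrightarrow> upward_stable (context_indep_model P)"
proof
  assume f: "faithful (context_indep_model P) (G_u K)"
  show "upward_stable (context_indep_model P)"
    unfolding upward_stable_def
  proof (intro allI impI ballI)
    fix i j k :: 'v and C
    assume *: "i \<noteq> j" "C \<subseteq> UNIV - {i, j}" "({i}, {j}, C) \<in> context_indep_model P" "k \<in> UNIV - {i, j}"
    then have "pairwise_disjoint {i} {j} C" "pairwise_disjoint {i} {j} (C \<union> {k})"
      by (auto simp: pairwise_disjoint_def)
    with f * show "({i}, {j}, C \<union> {k}) \<in> context_indep_model P"
      unfolding faithful_def by (metis insert_not_empty separated_mono sup_ge1)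
  qed
next
  assume u: "upward_stable (context_indep_model P)"
  show "faithful (context_indep_model P) (G_u K)"
    unfolding faithful_def
  proof (intro allI impI)
    fix A B C :: "'v set" assume d: "pairwise_disjoint A B C"
    \<comment> \<open>Separation and independence both reduce to conditions on single pairs, so
      comparing pairs suffices.\<close>
    have "\<not> connected_avoiding (G_u K) C i j \<longleftrightarrow> schur K C i j = 0" if "i \<in> A" "j \<in> B" for i j
    proof -
      have "i \<noteq> j" "i \<notin> C" "j \<notin> C" using d that by (auto simp: pairwise_disjoint_def)
      then show ?thesis
        using global_markov[OF assms, of i j C] connected_avoiding_imp_dependent[OF assms u, of i C j]
        by blast
    qed
    then show "separated (G_u K) A B C \<longleftrightarrow> (A, B, C) \<in> context_indep_model P"
      using d by (simp add: in_context_indep_model_iff[OF assms] separated_iff pairwise_disjoint_def)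
  qed
qed

end
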